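(* For every real $p>0$ and all real $a,b$, $$\frac{2}{\pi}\int_0^\infty \int_0^\infty\frac{\cos xy}{\cosh (p x)\,\cosh\frac{\pi y}{p}}\cos ax\,\cos by\,dx\,dy=\sqrt{2}\cdot \frac{\cosh\frac{\pi a}{2p}\,\cosh \frac{p b}{2}}{\cosh\frac{\pi a}{p}\,\cosh (pb)}-\frac{\cos ab}{\cosh \frac{\pi a}{p}\,\cosh (pb)}.$$ *)

theory Defs
  imports "HOL-Analysis.Analysis"
begin

end

(* Both integrations reduce to the single formula
     \<integral> exp (s x) / cosh x dx = pi / cos (pi s / 2)   over the real line, for |Re s| < 1,
   obtained from the rectangle with corners -R, R, R + i pi, -R + i pi: shifting by i pi multiplies
   the integrand by -exp (i pi s), and the only enclosed pole is i pi / 2.  With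
   u = pi y / (2 p) and v = pi a / (2 p), the x-integral is a multiple of
   sech (u + v) + sech (u - v) = 4 cosh u cosh v / (cosh 2u + cosh 2v); dividing by cosh 2u and
   taking partial fractions leaves, for the y-integral, the Fourier transforms of cosh u / cosh 2u
   (from s = 1/2 + it/2 and s = -1/2 + it/2) and of translates of sech. *)

theory Submission
  imports Defs "HOL-Complex_Analysis.Complex_Analysis" "HOL-Real_Asymp.Real_Asymp"
begin

section \<open>Zeros, growth and residue of the integrand\<close>

text \<open>The zeros of \<open>cosh\<close> are i pi (1/2 + n). Those for n = -1 and n = 1 lie on
  the two boundary lines, so this is the widest open strip around n = 0 that keeps a single
  zero.\<close>

lemma cosh_eq_0_strip:
  assumes "cosh z = 0" "- pi / 2 < Im z" "Im z < 3 * pi / 2"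
  shows "z = \<i> * pi / 2"
proof -
  have "exp (2 * z) = exp (\<i> * pi)"
    using assms(1) by (simp add: cosh_zero_iff exp_double)
  then obtain n :: int where n: "2 * z = \<i> * pi + (of_int (2 * n) * pi) * \<i>"
    unfolding exp_eq by blast
  have "2 * Im z = pi + 2 * n * pi"
    using arg_cong[OF n, of Im] by simp
  then have im: "Im z = pi * (1/2 + n)" by (simp add: field_simps)
  have "pi * (-1) < pi * n" "pi * n < pi * 1"
    using assms(2,3) unfolding im by (simp_all add: algebra_simps)
  then have "- 1 < real_of_int n" "real_of_int n < 1"
    using mult_less_cancel_left_pos[OF pi_gt_zero] by blast+
  then have "n = 0" by linarith
  then show ?thesis using n by (simp add: field_simps)
qed

lemma holomorphic_on_cosh: "cosh holomorphic_on A"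
  unfolding cosh_field_def by (intro holomorphic_intros) auto

text \<open>Reverse triangle inequality for exp z and exp (-z), whose moduli depend on
  \<open>Re z\<close> alone. It makes 1 / cosh small on a vertical line, uniformly in
  \<open>Im z\<close>.\<close>

lemma norm_cosh_ge: "\<bar>sinh (Re z)\<bar> \<le> norm (cosh z)"
proof -
  have "\<bar>norm (exp z) - norm (exp (-z))\<bar> \<le> norm (exp z + exp (-z))"
    using norm_triangle_ineq3[of "exp z" "- exp (-z)"] by simp
  then show ?thesis
    by (simp add: cosh_field_def sinh_field_def norm_divide)
qed

text \<open>At a simple pole the residue is the numerator over the derivative of the denominator,
  here sinh (i pi / 2) = i.\<close>

lemma residue_exp_div_cosh:
  "residue (\<lambda>z. exp (s * z) / cosh z) (\<i> * pi / 2) = exp (s * (\<i> * pi / 2)) / \<i>"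
proof (rule residue_simple_pole_deriv[where s = UNIV])
  have "sinh (\<i> * pi / 2) = \<i>" 
    by (simp add: sinh_conv_sin flip: mult.assoc) 
  then show "(cosh has_field_derivative \<i>) (at (\<i> * pi / 2))"
    by (auto intro!: derivative_eq_intros)
  show "cosh (\<i> * complex_of_real pi / 2) = 0"
    by (simp add: cosh_conv_cos flip: mult.assoc)
qed (auto intro!: holomorphic_intros holomorphic_on_cosh)

section \<open>The rectangle contour\<close>

lemma contour_integral_linepath_translate:
  "contour_integral (linepath (a + c) (b + c)) f = contour_integral (linepath a b) (\<lambda>z. f (z + c))"
proof -
  have "linepath (a + c) (b + c) x = linepath a b x + c" for x
    by (simp add: linepath_def algebra_simps)
  then show ?thesis by (simp add: contour_integral_integral)
qed

text \<open>Residue theorem at finite \<open>R\<close> with an explicit error. The two horizontal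
  sides combine into one real integral with factor 1 + exp (i pi s); the right-hand side bounds the
  two vertical sides and tends to 0 as \<open>R\<close> grows exactly when |Re s| < 1.\<close>

lemma exp_div_cosh_rectangle:
  fixes s :: complex and R :: real
  assumes R: "R > 0"
  shows "norm ((1 + exp (\<i> * pi * s)) * integral {-R..R} (\<lambda>x. exp (s * x) / cosh (complex_of_real x))
           - 2 * pi * exp (\<i> * pi * s / 2))
         \<le> 2 * pi * (exp (\<bar>Re s\<bar> * R + \<bar>Im s\<bar> * pi) / sinh R)"
proof -
  define f where "f = (\<lambda>z. exp (s * z) / cosh z)"
  define B where "B = exp (\<bar>Re s\<bar> * R + \<bar>Im s\<bar> * pi) / sinh R"
  \<comment> \<open>An open convex neighbourhood of the closed rectangle in which i pi / 2 is the
    only pole.\<close>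
  define S where "S = {z. - pi / 2 < Im z \<and> Im z < 3 * pi / 2}"
  define a1 a2 a3 a4 where "a1 = complex_of_real (-R)" "a2 = complex_of_real R"
    "a3 = complex_of_real R + \<i> * pi" "a4 = complex_of_real (-R) + \<i> * pi"
  note a_defs = a1_a2_a3_a4_def
  define P where "P = rectpath a1 a3"
  define I where "I = (\<lambda>a b. contour_integral (linepath a b) f)"
  have P: "P = linepath a1 a2 +++ linepath a2 a3 +++ linepath a3 a4 +++ linepath a4 a1"
  proof -
    have "Complex (Re a3) (Im a1) = a2" "Complex (Re a1) (Im a3) = a4"
      by (simp_all add: a_defs complex_eq_iff)
    then show ?thesis by (simp add: P_def rectpath_def)
  qed
  have S: "open S" "convex S"
  proof -
    have S': "S = {z. Im z > - pi / 2} \<inter> {z. Im z < 3 * pi / 2}"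
      by (auto simp: S_def)
    show "open S" unfolding S' by (intro open_Int open_halfspace_Im_gt open_halfspace_Im_lt)
    show "convex S" unfolding S' by (intro convex_Int convex_halfspace_Im_gt convex_halfspace_Im_lt)
  qed
  have cbox_sub: "cbox a1 a3 \<subseteq> S"
  proof
    fix z assume "z \<in> cbox a1 a3"
    then have "0 \<le> Im z" "Im z \<le> pi" by (auto simp: in_cbox_complex_iff a_defs)
    then show "z \<in> S" unfolding S_def mem_Collect_eq using pi_gt_zero by linarith
  qed
  have path_sub: "path_image P \<subseteq> S - {\<i> * pi / 2}"
  proof -
    have "path_image P = cbox a1 a3 - box a1 a3"
      unfolding P_def by (rule path_image_rectpath_cbox_minus_box) (use R in \<open>auto simp: a_defs\<close>)
    moreover have "\<i> * pi / 2 \<in> box a1 a3"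
      using R by (auto simp: in_box_complex_iff a_defs)
    ultimately show ?thesis using cbox_sub by auto
  qed
  have holo: "f holomorphic_on S - {\<i> * pi / 2}"
    unfolding f_def
    by (intro holomorphic_intros holomorphic_on_cosh) (auto simp: S_def dest: cosh_eq_0_strip)
  have cont: "continuous_on (path_image P) f"
    using holo path_sub holomorphic_on_imp_continuous_on continuous_on_subset by blast
  have seg: "path_image P = closed_segment a1 a2 \<union> closed_segment a2 a3 \<union> closed_segment a3 a4
      \<union> closed_segment a4 a1"
    by (auto simp: P path_image_join)
  have int: "f contour_integrable_on linepath a1 a2" "f contour_integrable_on linepath a2 a3"
      "f contour_integrable_on linepath a3 a4" "f contour_integrable_on linepath a4 a1"
    by (intro contour_integrable_continuous_linepath continuous_on_subset[OF cont]; force simp: seg)+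
  have residues: "contour_integral P f = 2 * pi * \<i> * (\<Sum>p\<in>{\<i> * pi / 2}. winding_number P p * residue f p)"
  proof (rule Residue_theorem[OF _ _ _ holo _ _ path_sub])
    show "\<forall>z. z \<notin> S \<longrightarrow> winding_number P z = 0"
    proof safe
      fix z assume "z \<notin> S"
      then have "z \<notin> cbox a1 a3"
        using cbox_sub by auto
      then show "winding_number P z = 0"
        unfolding P_def by (intro winding_number_rectpath_outside) (use R in \<open>auto simp: a_defs\<close>)
    qed
  qed (use S in \<open>auto simp: P_def convex_connected\<close>)
  have wind: "winding_number P (\<i> * pi / 2) = 1"
    unfolding P_def using R by (intro winding_number_rectpath) (auto simp: in_box_complex_iff a_defs)
  have res: "residue f (\<i> * pi / 2) = exp (\<i> * pi * s / 2) / \<i>"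
    unfolding f_def residue_exp_div_cosh by (simp add: mult_ac)
  have cancel: "2 * pi * \<i> * (1 * (e / \<i>)) = 2 * pi * e" for e :: complex
    by (simp add: field_simps)
  have single: "(\<Sum>p\<in>{q}. g p) = g q" for q :: complex and g :: "complex \<Rightarrow> complex"
    by simp
  have "2 * pi * exp (\<i> * pi * s / 2) = contour_integral P f"
    unfolding residues single wind res cancel ..
  also have "\<dots> = I a1 a2 + I a2 a3 + I a3 a4 + I a4 a1"
    using int by (simp add: P I_def contour_integrable_join)
  \<comment> \<open>The top side is the bottom side translated by i pi and traversed backwards. The
    sign from cosh (z + i pi) = - cosh z and the sign from the reversal cancel.\<close>
  also have "I a3 a4 = exp (\<i> * pi * s) * I a1 a2"
  proof -
    have "I a3 a4 = contour_integral (linepath a2 a1) (\<lambda>z. f (z + \<i> * pi))"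
    proof -
      have "a3 = a2 + \<i> * pi" "a4 = a1 + \<i> * pi" by (simp_all add: a_defs)
      then show ?thesis by (simp only: I_def contour_integral_linepath_translate)
    qed
    also have "(\<lambda>z. f (z + \<i> * pi)) = (\<lambda>z. - exp (\<i> * pi * s) * f z)"
    proof
      fix z
      have "cosh (z + \<i> * pi) = - cosh z"
        by (simp add: cosh_field_def exp_add exp_diff algebra_simps exp_minus)
      then show "f (z + \<i> * pi) = - exp (\<i> * pi * s) * f z"
        by (simp add: f_def algebra_simps exp_add)
    qed
    also have "contour_integral (linepath a2 a1) \<dots> = - exp (\<i> * pi * s) * I a2 a1"
      unfolding I_def
      by (rule contour_integral_lmul) (use int(1) contour_integrable_reversepath_eq[of "linepath a1 a2" f] in simp)
    also have "I a2 a1 = - I a1 a2"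
      unfolding I_def using contour_integral_reversepath[of "linepath a1 a2" f] by simp
    finally show ?thesis by simp
  qed
  also have "I a1 a2 = integral {-R..R} (\<lambda>x. exp (s * x) / cosh (complex_of_real x))"
    unfolding I_def
    by (subst contour_integral_linepath_Reals_eq) (use R in \<open>auto simp: a_defs f_def\<close>)
  finally have eq: "(1 + exp (\<i> * pi * s)) * integral {-R..R} (\<lambda>x. exp (s * x) / cosh (complex_of_real x))
      - 2 * pi * exp (\<i> * pi * s / 2) = - (I a2 a3 + I a4 a1)"
    by (simp add: algebra_simps)
  \<comment> \<open>On a vertical side |exp (s z)| = exp (Re s Re z - Im s Im z), where |Re z| = R
    and 0 \<le> Im z \<le> pi.\<close>
  have bound: "norm (f z) \<le> B" if "\<bar>Re z\<bar> = R" "0 \<le> Im z" "Im z \<le> pi" for z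
  proof -
    have "\<bar>sinh (Re z)\<bar> = sinh R" using that(1) R sinh_real_abs[of "Re z"] by simp
    then have c: "sinh R \<le> norm (cosh z)" "sinh R > 0" using norm_cosh_ge[of z] R by auto
    have "Re s * Re z \<le> \<bar>Re s\<bar> * R" using that(1) by (metis abs_ge_self abs_mult)
    moreover have "- (Im s * Im z) \<le> \<bar>Im s\<bar> * pi"
      using that(2,3) by (metis abs_ge_minus_self abs_mult abs_of_nonneg mult_left_mono abs_ge_zero order_trans)
    ultimately have "norm (exp (s * z)) \<le> exp (\<bar>Re s\<bar> * R + \<bar>Im s\<bar> * pi)"
      by simp
    then show ?thesis
      unfolding f_def B_def norm_divide using c by (intro frac_le) auto
  qed
  have "B \<ge> 0" using R by (simp add: B_def)
  have "norm (I a2 a3) \<le> B * norm (a3 - a2)"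
    unfolding I_def
    by (rule contour_integral_bound_linepath[OF int(2) \<open>B \<ge> 0\<close> bound])
      (use R in \<open>auto simp: a_defs closed_segment_same_Re closed_segment_eq_real_ivl
        pi_gt_zero[folded not_le]\<close>)
  moreover have "norm (I a4 a1) \<le> B * norm (a1 - a4)"
    unfolding I_def
    by (rule contour_integral_bound_linepath[OF int(4) \<open>B \<ge> 0\<close> bound])
      (use R in \<open>auto simp: a_defs closed_segment_same_Re closed_segment_eq_real_ivl
        pi_gt_zero[folded not_le]\<close>)
  \<comment> \<open>Each vertical side has length pi, hence the factor 2 pi.\<close>
  ultimately have "norm (I a2 a3 + I a4 a1) \<le> 2 * pi * B"
    by (intro norm_triangle_le) (simp add: a_defs norm_mult algebra_simps)
  then show ?thesis unfolding eq B_def by (simp only: norm_minus_cancel)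
qed

section \<open>Passage to the full real line\<close>

lemma integrable_exp_minus_abs:
  fixes c :: real
  assumes "c > 0"
  shows "integrable lborel (\<lambda>x. exp (- c * \<bar>x\<bar>))"
proof -
  have "set_integrable lebesgue {0..} (\<lambda>x. exp (- c * x))"
    by (intro nonnegative_absolutely_integrable_1 integrable_on_exp_minus_to_infinity assms) simp
  then have "integrable lborel (\<lambda>x. indicator {0..} x *\<^sub>R exp (- c * x))"
    unfolding set_integrable_def by (subst (asm) integrable_completion) auto
  also have "(\<lambda>x. indicator {0..} x *\<^sub>R exp (- c * x)) = (\<lambda>x. indicator {0..} x *\<^sub>R exp (- c * \<bar>x\<bar>))"
    by (auto simp: indicator_def)
  finally show ?thesis
    using has_bochner_integral_even_function[of "\<lambda>x. exp (- c * \<bar>x\<bar>)"]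
    by (auto simp: has_bochner_integral_iff)
qed

lemma cosh_ge_exp_abs: "exp \<bar>x\<bar> / 2 \<le> cosh (x :: real)"
  by (cases "x \<ge> 0") (auto simp: cosh_field_def)

text \<open>Since cosh x \<ge> exp |x| / 2, the integrand decays at least like exp (-(1 - |Re s|)
  |x|), and the hypothesis makes this rate positive.\<close>

lemma integrable_exp_div_cosh:
  fixes s :: complex
  assumes "\<bar>Re s\<bar> < 1"
  shows "integrable lborel (\<lambda>x. exp (s * x) / cosh (complex_of_real x))"
proof (rule Bochner_Integration.integrable_bound)
  show "integrable lborel (\<lambda>x. 2 * exp (- (1 - \<bar>Re s\<bar>) * \<bar>x\<bar>))"
    by (intro integrable_mult_right integrable_exp_minus_abs) (use assms in auto)
  show "(\<lambda>x. exp (s * x) / cosh (complex_of_real x)) \<in> borel_measurable lborel"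
    by (simp add: cosh_field_def)
  show "AE x in lborel. norm (exp (s * x) / cosh (complex_of_real x))
      \<le> norm (2 * exp (- (1 - \<bar>Re s\<bar>) * \<bar>x\<bar>))"
  proof (intro AE_I2)
    fix x :: real
    have "Re s * x \<le> \<bar>Re s\<bar> * \<bar>x\<bar>" by (metis abs_ge_self abs_mult)
    moreover have "cosh (complex_of_real x) = complex_of_real (cosh x)"
      by (simp add: cosh_field_def flip: exp_of_real)
    ultimately have "norm (exp (s * x) / cosh (complex_of_real x)) \<le> exp (\<bar>Re s\<bar> * \<bar>x\<bar>) / (exp \<bar>x\<bar> / 2)"
      unfolding norm_divide using cosh_ge_exp_abs[of x] by (intro frac_le) auto
    also have "\<dots> = norm (2 * exp (- (1 - \<bar>Re s\<bar>) * \<bar>x\<bar>))"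
      by (simp add: algebra_simps exp_diff)
    finally show "norm (exp (s * x) / cosh (complex_of_real x))
      \<le> norm (2 * exp (- (1 - \<bar>Re s\<bar>) * \<bar>x\<bar>))" .
  qed
qed

text \<open>The truncated integrals converge to the full one by dominated convergence, while the
  rectangle estimate forces the limit to satisfy (1 + exp (i pi s)) J = 2 pi exp (i pi s / 2).
  Dividing turns this into the cosine.\<close>

lemma integral_exp_div_cosh:
  fixes s :: complex
  assumes s: "\<bar>Re s\<bar> < 1"
  shows "(\<integral>x. exp (s * x) / cosh (complex_of_real x) \<partial>lborel) = pi / cos (pi * s / 2)"
proof -
  define f where "f = (\<lambda>x. exp (s * x) / cosh (complex_of_real x))"
  define J where "J = (\<integral>x. f x \<partial>lborel)"
  have f: "integrable lborel f" unfolding f_def by (rule integrable_exp_div_cosh[OF s])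
  \<comment> \<open>The contour argument delivers gauge integrals; they become Lebesgue integrals
    with an indicator so that dominated convergence applies.\<close>
  have fin: "integral {- real n..real n} f = (\<integral>x. indicator {- real n..real n} x *\<^sub>R f x \<partial>lborel)" for n
    using set_borel_integral_eq_integral(2)[of "{- real n..real n}" f]
    by (simp add: set_lebesgue_integral_def set_integrable_def integrable_mult_indicator f)
  have lim: "(\<lambda>n. integral {- real n..real n} f) \<longlonglongrightarrow> J"
    unfolding fin J_def
  proof (rule integral_dominated_convergence)
    show "AE x in lborel. (\<lambda>n. indicator {- real n..real n} x *\<^sub>R f x) \<longlonglongrightarrow> f x"
    proof (intro AE_I2 tendsto_eventually)
      fix x :: real
      show "\<forall>\<^sub>F n in sequentially. indicator {- real n..real n} x *\<^sub>R f x = f x"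
        using eventually_ge_at_top[of "nat \<lceil>\<bar>x\<bar>\<rceil>"]
        by eventually_elim (auto simp: indicator_def abs_le_iff nat_ceiling_le_eq)
    qed
    show "integrable lborel (\<lambda>x. norm (f x))" using f by simp
  qed (use f in \<open>auto simp: indicator_def\<close>)
  define D where "D = (1 + exp (\<i> * pi * s)) * J - 2 * pi * exp (\<i> * pi * s / 2)"
  have "(\<lambda>n. (1 + exp (\<i> * pi * s)) * integral {- real n..real n} f - 2 * pi * exp (\<i> * pi * s / 2))
      \<longlonglongrightarrow> D"
    unfolding D_def by (intro tendsto_intros lim)
  moreover have "(\<lambda>n. (1 + exp (\<i> * pi * s)) * integral {- real n..real n} f - 2 * pi * exp (\<i> * pi * s / 2))
      \<longlonglongrightarrow> 0"
  proof (rule Lim_null_comparison)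
    show "\<forall>\<^sub>F n in sequentially. norm ((1 + exp (\<i> * pi * s)) * integral {- real n..real n} f
        - 2 * pi * exp (\<i> * pi * s / 2)) \<le> 2 * pi * (exp (\<bar>Re s\<bar> * real n + \<bar>Im s\<bar> * pi) / sinh (real n))"
      using eventually_gt_at_top[of 0]
      by eventually_elim (use exp_div_cosh_rectangle in \<open>auto simp: f_def\<close>)
    \<comment> \<open>The error is rewritten as exp (-\<delta> n) times a factor tending to 1, up to
      a constant; a single positive rate \<open>\<delta>\<close> makes the decay visible to
      \<open>real_asymp\<close>.\<close>
    define \<delta> where "\<delta> = 1 - \<bar>Re s\<bar>"
    have "\<delta> > 0" using s by (simp add: \<delta>_def)
    then have "(\<lambda>n. 4 * pi * exp (\<bar>Im s\<bar> * pi) * (exp (- \<delta> * real n) * (exp (real n) / (exp (real n) - exp (- real n)))))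
        \<longlonglongrightarrow> 0"
      by real_asymp
    also have "exp (- \<delta> * real n) * exp (real n) = exp (\<bar>Re s\<bar> * real n)" for n
      by (simp add: \<delta>_def algebra_simps flip: exp_add)
    then have "(\<lambda>n. 4 * pi * exp (\<bar>Im s\<bar> * pi) * (exp (- \<delta> * real n) * (exp (real n) / (exp (real n) - exp (- real n)))))
        = (\<lambda>n. 2 * pi * (exp (\<bar>Re s\<bar> * real n + \<bar>Im s\<bar> * pi) / sinh (real n)))"
      by (simp add: sinh_field_def exp_add mult_ac)
    finally show "(\<lambda>n. 2 * pi * (exp (\<bar>Re s\<bar> * real n + \<bar>Im s\<bar> * pi) / sinh (real n))) \<longlonglongrightarrow> 0" .
  qed
  ultimately have "D = 0" by (rule LIMSEQ_unique)
  define E where "E = exp (\<i> * pi * s / 2)"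
  have "exp (\<i> * pi * s) = exp (\<i> * pi * s / 2 + \<i> * pi * s / 2)"
    by (rule arg_cong[of _ _ exp]) (simp add: field_simps)
  then have E: "exp (\<i> * pi * s) = E * E" "E \<noteq> 0"
    unfolding E_def exp_add by simp_all
  have eq: "(1 + E * E) * J = 2 * pi * E"
    using \<open>D = 0\<close> by (simp add: D_def E(1) flip: E_def)
  \<comment> \<open>Nonvanishing comes from the identity itself: a zero factor on the left would
    contradict 2 pi E \<noteq> 0.\<close>
  with E have "1 + E * E \<noteq> 0" by auto
  have half: "\<i> * (pi * s / 2) = \<i> * pi * s / 2" by simp
  have "cos (pi * s / 2) = (E + inverse E) / 2"
    by (simp only: cos_exp_eq E_def half exp_minus)
  also have "\<dots> = (1 + E * E) / (2 * E)"
    using E(2) by (simp add: field_simps)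
  finally have "pi / cos (pi * s / 2) = 2 * pi * E / (1 + E * E)" by simp
  also have "\<dots> = J"
    using eq \<open>1 + E * E \<noteq> 0\<close> by (metis nonzero_mult_div_cancel_left)
  finally show ?thesis by (simp add: J_def f_def)
qed

section \<open>Real Fourier transforms of hyperbolic quotients\<close>

text \<open>Real and imaginary parts of the complex formula at s = \<sigma> + i t. Here cos (pi s /
  2) = cos \<alpha> cosh \<beta> - i sin \<alpha> sinh \<beta>, and \<open>N\<close> is its squared
  modulus.\<close>

lemma has_bochner_integral_exp_trig_div_cosh:
  fixes \<sigma> t :: real
  assumes "\<bar>\<sigma>\<bar> < 1"
  defines "\<alpha> \<equiv> pi * \<sigma> / 2" and "\<beta> \<equiv> pi * t / 2"
  defines "N \<equiv> (cos \<alpha> * cosh \<beta>)\<^sup>2 + (sin \<alpha> * sinh \<beta>)\<^sup>2"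
  shows "has_bochner_integral lborel (\<lambda>x. exp (\<sigma> * x) * cos (t * x) / cosh x) (pi * (cos \<alpha> * cosh \<beta>) / N)"
    and "has_bochner_integral lborel (\<lambda>x. exp (\<sigma> * x) * sin (t * x) / cosh x) (pi * (sin \<alpha> * sinh \<beta>) / N)"
proof -
  define s where "s = Complex \<sigma> t"
  have int: "has_bochner_integral lborel (\<lambda>x. exp (s * x) / cosh (complex_of_real x)) (pi / cos (pi * s / 2))"
    using integrable_exp_div_cosh[of s] integral_exp_div_cosh[of s] assms(1)
    by (auto simp: has_bochner_integral_iff s_def)
  have cosh: "cosh (complex_of_real x) = complex_of_real (cosh x)" for x
    by (simp add: cosh_field_def flip: exp_of_real)
  have ReIm: "Re (pi * s / 2) = \<alpha>" "Im (pi * s / 2) = \<beta>"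
    by (simp_all add: s_def \<alpha>_def \<beta>_def)
  have c: "Re (cos (pi * s / 2)) = cos \<alpha> * cosh \<beta>" "Im (cos (pi * s / 2)) = - (sin \<alpha> * sinh \<beta>)"
    unfolding Re_cos Im_cos ReIm by (simp_all add: cosh_field_def sinh_field_def algebra_simps diff_divide_distrib)
  have "(\<lambda>x. Re (exp (s * x) / cosh (complex_of_real x))) = (\<lambda>x. exp (\<sigma> * x) * cos (t * x) / cosh x)"
    unfolding cosh by (simp add: Re_exp s_def)
  moreover have "Re (pi / cos (pi * s / 2)) = pi * (cos \<alpha> * cosh \<beta>) / N"
    by (simp add: Re_divide c N_def)
  ultimately show "has_bochner_integral lborel (\<lambda>x. exp (\<sigma> * x) * cos (t * x) / cosh x) (pi * (cos \<alpha> * cosh \<beta>) / N)"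
    using has_bochner_integral_Re[OF int] by simp
  have "(\<lambda>x. Im (exp (s * x) / cosh (complex_of_real x))) = (\<lambda>x. exp (\<sigma> * x) * sin (t * x) / cosh x)"
    unfolding cosh by (simp add: Im_exp s_def)
  moreover have "Im (pi / cos (pi * s / 2)) = pi * (sin \<alpha> * sinh \<beta>) / N"
    by (simp add: Im_divide c N_def)
  ultimately show "has_bochner_integral lborel (\<lambda>x. exp (\<sigma> * x) * sin (t * x) / cosh x) (pi * (sin \<alpha> * sinh \<beta>) / N)"
    using has_bochner_integral_Im[OF int] by simp
qed

lemma has_bochner_integral_scale:
  fixes f :: "real \<Rightarrow> real"
  assumes "has_bochner_integral lborel f I" "c > 0"
  shows "has_bochner_integral lborel (\<lambda>x. f (c * x)) (I / c)"
  using lborel_has_bochner_integral_real_affine_iff[of c f I 0] assms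
  by (simp add: divide_inverse mult.commute)

lemma has_bochner_integral_cos_div_cosh:
  "has_bochner_integral lborel (\<lambda>x. cos (t * x) / cosh (x :: real)) (pi / cosh (pi * t / 2))"
  using has_bochner_integral_exp_trig_div_cosh(1)[of 0 t] by (simp add: power2_eq_square)

text \<open>Substituting c + x for x and expanding cos (t (c + x)) leaves a cosine transform,
  already known, and a sine transform, which is 0 because its integrand is odd.\<close>

lemma has_bochner_integral_cos_div_cosh_shift:
  fixes c t :: real
  shows "has_bochner_integral lborel (\<lambda>x. cos (t * x) / cosh (x - c)) (cos (t * c) * pi / cosh (pi * t / 2))"
proof -
  have "has_bochner_integral lborel
      (\<lambda>x. cos (t * c) * (cos (t * x) / cosh x) - sin (t * c) * (sin (t * x) / cosh x))
      (cos (t * c) * (pi / cosh (pi * t / 2)) - sin (t * c) * 0)"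
    using has_bochner_integral_exp_trig_div_cosh(2)[of 0 t]
    by (intro has_bochner_integral_diff has_bochner_integral_mult_right has_bochner_integral_cos_div_cosh) simp
  moreover have "(\<lambda>x. cos (t * c) * (cos (t * x) / cosh x) - sin (t * c) * (sin (t * x) / cosh x))
      = (\<lambda>x. cos (t * (c + x)) / cosh (c + x - c))"
    by (simp add: distrib_left cos_add diff_divide_distrib)
  ultimately show ?thesis
    using lborel_has_bochner_integral_real_affine_iff[of 1 "\<lambda>x. cos (t * x) / cosh (x - c)" _ c] by simp
qed

text \<open>After rescaling by 2, the two exponentials in cosh x = (exp x + exp (-x)) / 2 are the
  cases \<sigma> = 1/2 and \<sigma> = -1/2 at frequency t / 2. Both give the same value
  \<open>V / 2\<close>.\<close>

lemma has_bochner_integral_cos_cosh_div_cosh_double: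
  "has_bochner_integral lborel (\<lambda>x. cos (t * x) * cosh x / cosh (2 * x :: real))
     (pi * sqrt 2 / 2 * cosh (pi * t / 4) / cosh (pi * t / 2))"
proof -
  define \<beta> where "\<beta> = pi * t / 4"
  define V where "V = pi * sqrt 2 * cosh \<beta> / cosh (pi * t / 2)"
  \<comment> \<open>At the angles pi/4 and -pi/4 both squares cos^2 and sin^2 are 1/2, so the
    denominator collapses to (cosh^2 \<beta> + sinh^2 \<beta>) / 2 = cosh (2 \<beta>) / 2.\<close>
  have val: "pi * (cos (pi * \<sigma> / 2) * cosh (pi * (t / 2) / 2)) /
        ((cos (pi * \<sigma> / 2) * cosh (pi * (t / 2) / 2))\<^sup>2 + (sin (pi * \<sigma> / 2) * sinh (pi * (t / 2) / 2))\<^sup>2) = V"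
    if "\<sigma> = 1 / 2 \<or> \<sigma> = - 1 / 2" for \<sigma> :: real
  proof -
    have c: "cos (pi * \<sigma> / 2) = sqrt 2 / 2" and s: "(sin (pi * \<sigma> / 2))\<^sup>2 = 1 / 2"
      using that by (elim disjE; hypsubst; simp add: cos_45 sin_45 power_divide)+
    have b: "pi * (t / 2) / 2 = \<beta>" "pi * t / 2 = 2 * \<beta>" by (simp_all add: \<beta>_def)
    have "cosh (2 * \<beta>) \<noteq> 0" by simp
    then show ?thesis
      unfolding V_def b c power_mult_distrib s cosh_double
      by (simp add: power_divide field_simps)
  qed
  have half: "has_bochner_integral lborel (\<lambda>x. exp (\<sigma> * (2 * x)) * cos (t / 2 * (2 * x)) / cosh (2 * x)) (V / 2)"
    if "\<sigma> = 1 / 2 \<or> \<sigma> = - 1 / 2" for \<sigma> :: real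
    using has_bochner_integral_scale[of _ _ 2, OF has_bochner_integral_exp_trig_div_cosh(1)[of \<sigma> "t / 2"]]
      that unfolding val[OF that] by auto
  have "has_bochner_integral lborel
      (\<lambda>x. (exp (1 / 2 * (2 * x)) * cos (t / 2 * (2 * x)) / cosh (2 * x)
          + exp (- 1 / 2 * (2 * x)) * cos (t / 2 * (2 * x)) / cosh (2 * x)) * (1 / 2)) ((V / 2 + V / 2) * (1 / 2))"
    by (intro has_bochner_integral_mult_left has_bochner_integral_add half) auto
  also have "(\<lambda>x. (exp (1 / 2 * (2 * x)) * cos (t / 2 * (2 * x)) / cosh (2 * x)
          + exp (- 1 / 2 * (2 * x)) * cos (t / 2 * (2 * x)) / cosh (2 * x)) * (1 / 2))
      = (\<lambda>x. cos (t * x) * cosh x / cosh (2 * x))"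
  proof
    fix x :: real
    show "(exp (1 / 2 * (2 * x)) * cos (t / 2 * (2 * x)) / cosh (2 * x)
        + exp (- 1 / 2 * (2 * x)) * cos (t / 2 * (2 * x)) / cosh (2 * x)) * (1 / 2)
      = cos (t * x) * cosh x / cosh (2 * x)"
      unfolding cosh_field_def[of x] by (simp add: add_divide_distrib distrib_left mult_ac)
  qed
  finally show ?thesis by (simp add: V_def \<beta>_def mult_ac)
qed

section \<open>Hyperbolic identities and the inner integral\<close>

lemma sech_add_sech_diff:
  fixes u v :: real
  shows "1 / cosh (u + v) + 1 / cosh (u - v) = 4 * cosh u * cosh v / (cosh (2 * u) + cosh (2 * v))"
proof -
  have "cosh (2 * u) + cosh (2 * v) = 2 * (cosh (u + v) * cosh (u - v))"
    using cosh_add[of "u + v" "u - v"] cosh_diff[of "u + v" "u - v"] by simp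
  moreover have "cosh (u - v) + cosh (u + v) = 2 * cosh u * cosh v"
    by (simp add: cosh_add cosh_diff)
  moreover have "cosh (u + v) \<noteq> 0" "cosh (u - v) \<noteq> 0" by simp_all
  ultimately show ?thesis by (simp add: add_frac_eq add.commute)
qed

text \<open>Bridge from the transforms, which are computed over the real line, to the half-line
  integrals of the theorem.\<close>

lemma set_integral_even_half_line:
  fixes f :: "real \<Rightarrow> real"
  assumes f: "has_bochner_integral lborel f I" and even: "\<And>x. f (- x) = f x"
  shows "(LBINT x:{0..}. f x) = I / 2"
proof -
  have "integrable lborel (\<lambda>x. indicator {0..} x *\<^sub>R f x)"
    using f by (intro integrable_mult_indicator) (auto simp: has_bochner_integral_iff)
  then have "has_bochner_integral lborel f (2 *\<^sub>R (LBINT x:{0..}. f x))"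
    unfolding set_lebesgue_integral_def
    by (intro has_bochner_integral_even_function even has_bochner_integral_integrable)
  with f show ?thesis by (metis has_bochner_integral_eq real_scaleR_def nonzero_mult_div_cancel_left zero_neq_numeral)
qed

text \<open>The product of cosines splits into frequencies y + a and y - a. Each transform gives a
  sech, at u + v and at u - v, and the sum of the two is rewritten as one fraction.\<close>

lemma integral_cos_cos_div_cosh:
  fixes p a y :: real
  assumes p: "p > 0"
  defines "u \<equiv> pi * y / (2 * p)" and "v \<equiv> pi * a / (2 * p)"
  shows "(LBINT x:{0..}. cos (x * y) * cos (a * x) / cosh (p * x))
    = pi / p * (cosh u * cosh v / (cosh (2 * u) + cosh (2 * v)))"
proof -
  have scale: "t / p * (p * x) = t * x" for t x
    using p by simp
  have int: "has_bochner_integral lborel (\<lambda>x. cos (t / p * (p * x)) / cosh (p * x))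
      (pi / cosh (pi * (t / p) / 2) / p)" for t
    using has_bochner_integral_scale[OF has_bochner_integral_cos_div_cosh p] .
  have "has_bochner_integral lborel
      (\<lambda>x. (cos ((y + a) / p * (p * x)) / cosh (p * x) + cos ((y - a) / p * (p * x)) / cosh (p * x)) * (1 / 2))
      ((pi / cosh (pi * ((y + a) / p) / 2) / p + pi / cosh (pi * ((y - a) / p) / 2) / p) * (1 / 2))"
    by (intro has_bochner_integral_mult_left has_bochner_integral_add int)
  also have "(\<lambda>x. (cos ((y + a) / p * (p * x)) / cosh (p * x) + cos ((y - a) / p * (p * x)) / cosh (p * x)) * (1 / 2))
      = (\<lambda>x. cos (x * y) * cos (a * x) / cosh (p * x))"
  proof
    fix x :: real
    have "cos ((y + a) * x) + cos ((y - a) * x) = 2 * (cos (x * y) * cos (a * x))"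
      by (simp add: algebra_simps cos_add cos_diff)
    then show "(cos ((y + a) / p * (p * x)) / cosh (p * x) + cos ((y - a) / p * (p * x)) / cosh (p * x)) * (1 / 2)
        = cos (x * y) * cos (a * x) / cosh (p * x)"
      unfolding scale add_divide_distrib[symmetric] by simp
  qed
  also have "(pi / cosh (pi * ((y + a) / p) / 2) / p + pi / cosh (pi * ((y - a) / p) / 2) / p) * (1 / 2)
      = pi / (2 * p) * (1 / cosh (u + v) + 1 / cosh (u - v))"
  proof -
    have "pi * ((y + a) / p) / 2 = u + v" "pi * ((y - a) / p) / 2 = u - v"
      using p by (simp_all add: u_def v_def field_simps)
    then show ?thesis by (simp add: distrib_left mult_ac)
  qed
  finally have "(LBINT x:{0..}. cos (x * y) * cos (a * x) / cosh (p * x))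
      = pi / (2 * p) * (1 / cosh (u + v) + 1 / cosh (u - v)) / 2"
    by (rule set_integral_even_half_line) simp
  then show ?thesis unfolding sech_add_sech_diff by simp
qed

text \<open>With C = cosh 2u and D = cosh 2v this is 1 / ((C + D) C) = (1 / C - 1 / (C + D)) / D.
  The 1 / (C + D) term is turned back into two translates of sech, so that every term has a known
  Fourier transform in u.\<close>

lemma partial_fractions_cosh:
  fixes u v :: real
  shows "cosh u * cosh v / (cosh (2 * u) + cosh (2 * v)) / cosh (2 * u)
    = (cosh v * (cosh u / cosh (2 * u)) - (1 / cosh (u + v) + 1 / cosh (u - v)) / 4) / cosh (2 * v)"
proof -
  have "cosh (2 * u) > 0" "cosh (2 * v) > 0" by simp_all
  then have "cosh (2 * u) + cosh (2 * v) \<noteq> 0" by linarith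
  moreover have "cosh (2 * u) \<noteq> 0" "cosh (2 * v) \<noteq> 0" by simp_all
  ultimately show ?thesis
    unfolding sech_add_sech_diff
    by (simp add: divide_simps) (simp add: algebra_simps)
qed

section \<open>Absolute integrability over the plane\<close>

text \<open>The cosines are bounded by 1, leaving the product sech (p x) sech (q y), which is
  integrable by Fubini since each factor is.\<close>

lemma integrable_cos_cos_cos_div_cosh_cosh:
  fixes p q a b :: real
  assumes "p > 0" "q > 0"
  shows "integrable lborel (\<lambda>(x, y). cos (x * y) / (cosh (p * x) * cosh (q * y)) * cos (a * x) * cos (b * y))"
proof -
  have sech: "integrable lborel (\<lambda>x. 1 / cosh (c * x))" if "c > 0" for c :: real
    using has_bochner_integral_scale[OF has_bochner_integral_cos_div_cosh[of 0] that]
    by (simp add: has_bochner_integral_iff)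
  have dom: "integrable (lborel \<Otimes>\<^sub>M lborel) (\<lambda>(x, y). 1 / cosh (p * x) * (1 / cosh (q * y)))"
  proof (rule lborel_pair.Fubini_integrable)
    show "(\<lambda>(x, y). 1 / cosh (p * x) * (1 / cosh (q * y))) \<in> borel_measurable (lborel \<Otimes>\<^sub>M lborel)"
      by (simp add: cosh_field_def)
    have "norm (case (x, y) of (x, y) \<Rightarrow> 1 / cosh (p * x) * (1 / cosh (q * y))) = 1 / cosh (p * x) * (1 / cosh (q * y))" for x y
      by (simp add: abs_mult)
    then show "integrable lborel
        (\<lambda>x. LBINT y. norm (case (x, y) of (x, y) \<Rightarrow> 1 / cosh (p * x) * (1 / cosh (q * y))))"
      by (simp only: integral_mult_right_zero) (intro integrable_mult_left sech assms)
    show "AE x in lborel. integrable lborel (\<lambda>y. case (x, y) of (x, y) \<Rightarrow> 1 / cosh (p * x) * (1 / cosh (q * y)))"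
      unfolding prod.case by (intro AE_I2 integrable_mult_right sech assms)
  qed
  have "integrable (lborel \<Otimes>\<^sub>M lborel)
      (\<lambda>(x, y). cos (x * y) / (cosh (p * x) * cosh (q * y)) * cos (a * x) * cos (b * y))"
  proof (rule Bochner_Integration.integrable_bound[OF dom])
    show "(\<lambda>(x, y). cos (x * y) / (cosh (p * x) * cosh (q * y)) * cos (a * x) * cos (b * y))
        \<in> borel_measurable (lborel \<Otimes>\<^sub>M lborel)"
      by (simp add: cosh_field_def)
    have "\<bar>cos (x * y) / (cosh (p * x) * cosh (q * y)) * cos (a * x) * cos (b * y)\<bar>
        \<le> 1 / (cosh (p * x) * cosh (q * y))" for x y
    proof -
      have "\<bar>cos (x * y)\<bar> * \<bar>cos (a * x)\<bar> * \<bar>cos (b * y)\<bar> \<le> 1 * 1 * 1"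
        by (intro mult_mono) auto
      then show ?thesis by (simp add: abs_mult divide_right_mono)
    qed
    then show "AE z in lborel \<Otimes>\<^sub>M lborel.
        norm (case z of (x, y) \<Rightarrow> cos (x * y) / (cosh (p * x) * cosh (q * y)) * cos (a * x) * cos (b * y))
        \<le> norm (case z of (x, y) \<Rightarrow> 1 / cosh (p * x) * (1 / cosh (q * y)))"
      by (intro AE_I2) (auto simp: abs_mult)
  qed
  then show ?thesis by (simp only: lborel_prod)
qed

section \<open>Evaluation of the double integral\<close>

text \<open>The value alone would say little, as the integral of a non-integrable function defaults
  to 0. The first conjunct therefore records absolute convergence over the quadrant.\<close>

theorem mainTheorem7:
  fixes p a b :: real
  assumes "p > 0"
  shows
    "set_integrable lborel ({0..} \<times> {0..})
       (\<lambda>(x::real, y::real).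
          cos (x * y) / (cosh (p * x) * cosh (pi * y / p)) * cos (a * x) * cos (b * y))
     \<and> 2 / pi *
       (LBINT y:{0..}. (LBINT x:{0..}.
          cos (x * y) / (cosh (p * x) * cosh (pi * y / p)) * cos (a * x) * cos (b * y)))
       = sqrt 2 * (cosh (pi * a / (2 * p)) * cosh (p * b / 2))
                  / (cosh (pi * a / p) * cosh (p * b))
         - cos (a * b) / (cosh (pi * a / p) * cosh (p * b))"
proof
  have "integrable lborel (\<lambda>(x, y). cos (x * y) / (cosh (p * x) * cosh (pi * y / p)) * cos (a * x) * cos (b * y))"
    using integrable_cos_cos_cos_div_cosh_cosh[of p "pi / p" a b] assms by simp
  then show "set_integrable lborel ({0..} \<times> {0..})
       (\<lambda>(x::real, y::real). cos (x * y) / (cosh (p * x) * cosh (pi * y / p)) * cos (a * x) * cos (b * y))"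
    unfolding set_integrable_def by (intro integrable_mult_indicator) (auto simp: borel_Times)
next
  \<comment> \<open>The outer variable becomes u = c y, so that pi y / p = 2 u; \<open>t\<close> is
    chosen to give b y = t u. \<open>K\<close> is the outer integrand after partial fractions, with
    sech (u + v) written as a translate by \<open>- v\<close>, and \<open>V\<close> is its integral
    over the real line.\<close>
  define v where "v = pi * a / (2 * p)"
  define t where "t = 2 * p * b / pi"
  define c where "c = pi / (2 * p)"
  define K where "K = (\<lambda>u. (cosh v * (cos (t * u) * cosh u / cosh (2 * u))
      - (cos (t * u) / cosh (u - - v) + cos (t * u) / cosh (u - v)) / 4) * (pi / p / cosh (2 * v)))"
  define V where "V = (cosh v * (pi * sqrt 2 / 2 * cosh (pi * t / 4) / cosh (pi * t / 2))
      - (cos (t * - v) * pi / cosh (pi * t / 2) + cos (t * v) * pi / cosh (pi * t / 2)) / 4) * (pi / p / cosh (2 * v))"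
  have "c > 0" using assms by (simp add: c_def)
  have "has_bochner_integral lborel K V"
    unfolding K_def V_def
    by (intro has_bochner_integral_mult_left has_bochner_integral_diff has_bochner_integral_mult_right
        has_bochner_integral_divide_zero has_bochner_integral_add
        has_bochner_integral_cos_cosh_div_cosh_double has_bochner_integral_cos_div_cosh_shift)
  then have int: "has_bochner_integral lborel (\<lambda>y. K (c * y)) (V / c)"
    using \<open>c > 0\<close> by (rule has_bochner_integral_scale)
  have "(LBINT x:{0..}. cos (x * y) / (cosh (p * x) * cosh (pi * y / p)) * cos (a * x) * cos (b * y)) = K (c * y)" for y
  proof -
    define u where "u = c * y"
    have u: "u = pi * y / (2 * p)" "2 * u = pi * y / p" "b * y = t * u"
      using assms by (simp_all add: u_def c_def t_def)
    have "(LBINT x:{0..}. cos (x * y) / (cosh (p * x) * cosh (pi * y / p)) * cos (a * x) * cos (b * y))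
        = (LBINT x:{0..}. cos (t * u) / cosh (2 * u) * (cos (x * y) * cos (a * x) / cosh (p * x)))"
      unfolding u(2,3) by (simp add: mult_ac)
    also have "\<dots> = cos (t * u) / cosh (2 * u) * (LBINT x:{0..}. cos (x * y) * cos (a * x) / cosh (p * x))"
      by (rule set_integral_mult_right)
    also have "\<dots> = cos (t * u) * (pi / p) * (cosh u * cosh v / (cosh (2 * u) + cosh (2 * v)) / cosh (2 * u))"
      unfolding integral_cos_cos_div_cosh[OF assms] u(1)[symmetric] v_def[symmetric] by (simp add: mult_ac)
    also have "\<dots> = K u"
      unfolding partial_fractions_cosh K_def by (simp add: field_simps)
    finally show ?thesis by (simp add: u_def)
  qed
  then have "(LBINT y:{0..}. (LBINT x:{0..}.
        cos (x * y) / (cosh (p * x) * cosh (pi * y / p)) * cos (a * x) * cos (b * y)))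
      = (LBINT y:{0..}. K (c * y))"
    by simp
  also have "\<dots> = V / c / 2"
  proof (rule set_integral_even_half_line[OF int])
    \<comment> \<open>Reflection exchanges the two translates of sech, so their sum is even.\<close>
    fix y
    have "cosh (- u - v) = cosh (u + v)" "cosh (v - u) = cosh (u - v)" for u :: real
      by (simp_all add: abs_if)
    note symm = this[of "c * y"]
    show "K (c * - y) = K (c * y)" by (simp add: K_def symm add.commute)
  qed
  also have "V / c / 2 = (cosh v * (pi * sqrt 2 / 2 * cosh (p * b / 2) / cosh (p * b))
      - cos (a * b) * pi / cosh (p * b) / 2) / cosh (2 * v)"
  proof -
    have args: "pi * t / 4 = p * b / 2" "pi * t / 2 = p * b" "t * v = a * b"
      using assms by (simp_all add: t_def v_def)
    \<comment> \<open>The factor pi / p divided by c is 2, which cancels the 1/2 from restricting to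
      the half line.\<close>
    have cancel: "X * (pi / p / d) / c / 2 = X / d" for X d
      using assms by (simp add: c_def)
    show ?thesis unfolding V_def cancel args by (simp add: args mult_ac)
  qed
  finally show "2 / pi *
       (LBINT y:{0..}. (LBINT x:{0..}.
          cos (x * y) / (cosh (p * x) * cosh (pi * y / p)) * cos (a * x) * cos (b * y)))
       = sqrt 2 * (cosh (pi * a / (2 * p)) * cosh (p * b / 2))
                  / (cosh (pi * a / p) * cosh (p * b))
         - cos (a * b) / (cosh (pi * a / p) * cosh (p * b))"
    by (simp add: v_def field_simps)
qed

end
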